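(* Fix integers $m,n\ge 2$ and let $$\mathcal{W}_{m,n}(\mathbb{Z};H)=\{A_1A_2\cdots A_m : A_1,\dots,A_m\in\mathcal{M}_n(\mathbb{Z};H)\}.$$ Then, as $H\to\infty$, $$\#\mathcal{W}_{m,n}(\mathbb{Z};H)\ge H^{n^2+mn-n+o(1)}.$$ Moreover, if $m\ge 6$, then $\#\mathcal{W}_{m,n}(\mathbb{Z};H)=o(H^{mn^2})$ as $H\to\infty$.
   Context: For positive integers $n,H$, $\mathcal{M}_n(\mathbb{Z};H)$ denotes the set of $n\times n$ integer matrices $(a_{ij})$ with $|a_{ij}|\le H$ for all $i,j$. A bound $X\ge H^{c+o(1)}$ means: for every $\varepsilon>0$, $X\ge H^{c-\varepsilon}$ for all sufficiently large $H$. $U(H)=o(V(H))$ means $U(H)/V(H)\to 0$ as $H\to\infty$. *)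

theory Defs
  imports "HOL-Analysis.Analysis" "HOL-Library.Landau_Symbols"
begin

definition bounded_mats :: "nat \<Rightarrow> (int^'n^'n) set" where
  "bounded_mats H = {A. \<forall>i j. \<bar>A $ i $ j\<bar> \<le> int H}"

definition mat_list_prod :: "(int^'n^'n) list \<Rightarrow> int^'n^'n" where
  "mat_list_prod As = foldr (\<lambda>A B. A ** B) As (mat 1)"

definition W_set :: "nat \<Rightarrow> nat \<Rightarrow> (int^'n^'n) set" where
  "W_set m H = {mat_list_prod As | As. length As = m \<and> set As \<subseteq> bounded_mats H}"

end

theory Submission
  imports Defs "HOL-Number_Theory.Cong" "HOL-Computational_Algebra.Primes" "HOL-Real_Asymp.Real_Asymp"
begin

text \<open>
  Lower bound: multiply a matrix with positive entries on the left by \<open>m - 1\<close> positive diagonal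
  matrices. There are \<open>H^(n^2 + (m - 1) n)\<close> such products, and since every diagonal entry divides
  an entry of the product, the divisor bound shows that each value is attained only
  \<open>H^o(1)\<close> times.

  Upper bound: let \<open>\<alpha>\<close> be the density of matrices that are singular modulo a prime \<open>p\<close>. A
  generic matrix is singular modulo \<open>p\<close> with probability \<open>\<alpha>\<close>, a product of \<open>m\<close> generic matrices
  with probability \<open>1 - (1 - \<alpha>)^m\<close>, about \<open>m \<alpha>\<close>. These events are independent for different
  primes and \<open>\<alpha> \<ge> 1 / (n p)\<close> has a divergent sum, so the two distributions become
  asymptotically singular to each other. Quantitatively, let \<open>N(B)\<close> be the number of primes in a
  finite set modulo which \<open>B\<close> is singular. For every \<open>c > 0\<close> we have
  \<open>1 \<le> 2^N(B) / c + c 2^-N(B)\<close>; the first term is summed over the whole box containing all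
  products, the second one over all tuples of factors.
\<close>

section \<open>Divisors and primes\<close>

lemma card_divisors_prime_power_mult_le:
  fixes p k :: nat
  assumes "prime p" "k > 0"
  shows "card {d. d dvd p ^ a * k} \<le> Suc a * card {d. d dvd k}"
proof -
  have "{d. d dvd p ^ a * k} \<subseteq> (\<lambda>(i, d). p ^ i * d) ` ({..a} \<times> {d. d dvd k})"
  proof
    fix d assume "d \<in> {d. d dvd p ^ a * k}"
    then obtain x y where xy: "d = x * y" "x dvd p ^ a" "y dvd k"
      using division_decomp[of d "p ^ a" k] by auto
    then obtain i where "i \<le> a" "x = p ^ i"
      using divides_primepow_nat[OF assms(1)] by auto
    with xy show "d \<in> (\<lambda>(i, d). p ^ i * d) ` ({..a} \<times> {d. d dvd k})"
      by (intro image_eqI[of _ _ "(i, y)"]) auto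
  qed
  then have "card {d. d dvd p ^ a * k} \<le> card ((\<lambda>(i, d). p ^ i * d) ` ({..a} \<times> {d. d dvd k}))"
    using assms by (intro card_mono) auto
  also have "\<dots> \<le> card ({..a} \<times> {d. d dvd k})"
    using assms by (intro card_image_le) auto
  finally show ?thesis by (simp add: card_cartesian_product)
qed

text \<open>Split off one full prime power \<open>p ^ a\<close> at a time. It contributes the ratio
  \<open>(a + 1) / p powr (\<delta> * a)\<close>, which is at most 1 for large \<open>p\<close> and
  at most a constant \<open>K\<close> for each of the finitely many small primes. Hence
  \<open>C\<close> can be \<open>K\<close> to the number of small primes.\<close>

lemma divisor_bound:
  fixes \<delta> :: real
  assumes "\<delta> > 0"
  obtains C :: real where "C \<ge> 1" "\<And>N::nat. N > 0 \<Longrightarrow> real (card {d. d dvd N}) \<le> C * real N powr \<delta>"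
proof -
  \<comment> \<open>From \<open>p \<ge> L\<close> follows \<open>p powr \<delta> \<ge> 2\<close>,
    and \<open>2 ^ a\<close> exceeds \<open>a\<close>. For smaller primes
    \<open>p powr (\<delta> * a)\<close> is still at least \<open>1 + a * c\<close>, and
    \<open>K * c = c + 1\<close> gives \<open>K * (1 + a * c) \<ge> 1 + a\<close>.\<close>
  define L where "L = 2 powr (1 / \<delta>)"
  define c where "c = \<delta> * ln 2"
  define K where "K = 1 + 1 / c"
  have c: "c > 0" using assms by (simp add: c_def)
  have K: "K \<ge> 1" using c by (simp add: K_def)
  define S where "S = {p::nat. prime p \<and> real p < L}"
  have finS: "finite S"
  proof (rule finite_subset)
    show "S \<subseteq> {..nat \<lceil>L\<rceil>}"
    proof
      fix p assume "p \<in> S"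
      then have "real p < L" by (simp add: S_def)
      then have "real p \<le> real (nat \<lceil>L\<rceil>)" by linarith
      then show "p \<in> {..nat \<lceil>L\<rceil>}" by simp
    qed
  qed auto
  \<comment> \<open>The exponent counts only the small primes dividing \<open>N\<close>, so that
    removing the prime \<open>p\<close> loses a factor \<open>K\<close> exactly when
    \<open>p\<close> lies in \<open>S\<close>.\<close>
  have key: "real (card {d. d dvd N}) \<le> K ^ card (S \<inter> prime_factors N) * real N powr \<delta>"
    if "N > 0" for N :: nat
    using that
  proof (induction N rule: less_induct)
    case (less N)
    show ?case
    proof (cases "N = 1")
      case True
      then show ?thesis by simp
    next
      case False
      then obtain p where p: "prime p" "p dvd N"
        using prime_factor_nat by blast
      define a where "a = multiplicity p N"
      obtain k where k: "N = p ^ a * k" "\<not> p dvd k"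
        using less.prems p unfolding a_def
        by (metis multiplicity_decompose' not_prime_unit not_less0)
      have k0: "k > 0" using k less.prems by (auto intro: Nat.gr0I)
      have a: "a > 0" using p less.prems unfolding a_def
        by (metis multiplicity_eq_zero_iff neq0_conv not_prime_unit not_less0)
      have p2: "p \<ge> 2" using p by (simp add: prime_ge_2_nat)
      have "p ^ a \<ge> 2" using a p2 self_le_power[of p a] by simp
      then have "k < N" using k k0 by simp
      with less.IH k0 have IH: "real (card {d. d dvd k}) \<le> K ^ card (S \<inter> prime_factors k) * real k powr \<delta>"
        by blast
      have pf: "prime_factors N = insert p (prime_factors k)"
        using k k0 p a less.prems
        by (auto simp: in_prime_factors_iff prime_dvd_mult_iff prime_dvd_power_iff primes_dvd_imp_eq)
      have pn: "p \<notin> prime_factors k" using k(2) by auto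
      have pow: "real N powr \<delta> = real p powr (\<delta> * a) * real k powr \<delta>"
        using k p2 k0 by (simp add: powr_mult powr_realpow[symmetric] powr_powr mult.commute)
      have fac: "real (Suc a) \<le> (if p \<in> S then K else 1) * real p powr (\<delta> * a)"
      proof (cases "p \<in> S")
        case True
        have "1 + a * c \<le> exp (a * c)" by (rule exp_ge_add_one_self)
        also have "exp (a * c) = 2 powr (\<delta> * a)" by (simp add: powr_def c_def mult_ac)
        also have "\<dots> \<le> real p powr (\<delta> * a)" using p2 assms by (intro powr_mono2) auto
        finally have 1: "1 + a * c \<le> real p powr (\<delta> * a)" .
        have "real (Suc a) \<le> K * (1 + a * c)" using c by (simp add: K_def algebra_simps)
        also have "\<dots> \<le> K * real p powr (\<delta> * a)" using 1 K by (intro mult_left_mono) auto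
        finally show ?thesis using True by simp
      next
        case False
        then have pL: "real p \<ge> L" using p by (simp add: S_def)
        have "real (Suc a) \<le> 2 ^ a"
          by (metis Suc_leI less_exp of_nat_le_iff of_nat_numeral of_nat_power)
        also have "\<dots> = L powr (\<delta> * a)" using assms by (simp add: L_def powr_powr powr_realpow)
        also have "\<dots> \<le> real p powr (\<delta> * a)" using pL assms by (intro powr_mono2) (auto simp: L_def)
        finally show ?thesis using False by simp
      qed
      have "real (card {d. d dvd N}) \<le> real (Suc a) * real (card {d. d dvd k})"
        using card_divisors_prime_power_mult_le[OF p(1) k0, of a] k(1)
        by (metis of_nat_le_iff of_nat_mult)
      also have "\<dots> \<le> ((if p \<in> S then K else 1) * real p powr (\<delta> * a)) * (K ^ card (S \<inter> prime_factors k) * real k powr \<delta>)"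
        using fac IH K by (intro mult_mono) auto
      also have "\<dots> = ((if p \<in> S then K else 1) * K ^ card (S \<inter> prime_factors k)) * real N powr \<delta>"
        by (simp add: pow mult_ac)
      also have "(if p \<in> S then K else 1) * K ^ card (S \<inter> prime_factors k) = K ^ card (S \<inter> prime_factors N)"
        using pn finS by (simp add: pf)
      finally show ?thesis .
    qed
  qed
  show ?thesis
  proof (rule that[of "K ^ card S"])
    show "1 \<le> K ^ card S" using K by (rule one_le_power)
    fix N :: nat assume "N > 0"
    note key[OF this]
    also have "K ^ card (S \<inter> prime_factors N) * real N powr \<delta> \<le> K ^ card S * real N powr \<delta>"
      using K finS by (intro mult_right_mono power_increasing card_mono) auto
    finally show "real (card {d. d dvd N}) \<le> K ^ card S * real N powr \<delta>" .
  qed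
qed

section \<open>Divergence of the sum of the reciprocals of the primes\<close>

text \<open>A finite form of the Euler product: each new prime contributes a geometric series,
  summed over the exponent of that prime in \<open>k\<close>.\<close>

lemma sum_reciprocals_smooth_le:
  fixes P :: "nat set"
  assumes "finite P" "\<And>p. p \<in> P \<Longrightarrow> prime p"
  shows "(\<Sum>k | k \<in> {1..N} \<and> prime_factors k \<subseteq> P. 1 / real k) \<le> (\<Prod>p\<in>P. 1 / (1 - 1 / real p))"
  using assms
proof (induction P rule: finite_induct)
  case empty
  have "{k. k \<in> {1..N} \<and> prime_factors k \<subseteq> {}} \<subseteq> {1}"
    by (auto simp: prime_factorization_empty_iff)
  then have "(\<Sum>k | k \<in> {1..N} \<and> prime_factors k \<subseteq> {}. 1 / real k) \<le> (\<Sum>k\<in>{1}. 1 / real k)"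
    by (intro sum_mono2) auto
  then show ?case by simp
next
  case (insert p P)
  let ?A = "\<lambda>P. {k. k \<in> {1..N} \<and> prime_factors k \<subseteq> P}"
  have p: "prime p" "p \<ge> 2" using insert.prems by (auto simp: prime_ge_2_nat)
  have fin: "finite (?A Q)" for Q by auto
  have sub: "?A (insert p P) \<subseteq> (\<lambda>(a, k). p ^ a * k) ` ({..N} \<times> ?A P)"
  proof
    fix n assume n: "n \<in> ?A (insert p P)"
    define a where "a = multiplicity p n"
    have n0: "n \<noteq> 0" using n by auto
    then obtain k where k: "n = p ^ a * k" "\<not> p dvd k"
      using p unfolding a_def by (metis multiplicity_decompose' not_prime_unit)
    have k0: "k > 0" using k n0 by (auto intro: Nat.gr0I)
    have "prime_factors k \<subseteq> prime_factors n" using k n0 by (intro dvd_prime_factors) auto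
    moreover have "p \<notin> prime_factors k" using k by auto
    ultimately have "prime_factors k \<subseteq> P" using n by auto
    moreover have "k \<le> n" "p ^ a \<le> n" using k k0 p by auto
    \<comment> \<open>A crude bound on the exponent suffices:
      \<open>a \<le> p ^ a \<le> n \<le> N\<close> keeps the index set finite.\<close>
    moreover have "a \<le> p ^ a" using p by (simp add: less_imp_le power_gt_expt)
    moreover have "n \<le> N" using n by simp
    ultimately have "prime_factors k \<subseteq> P" "a \<le> N" "k \<le> N" by auto
    then show "n \<in> (\<lambda>(a, k). p ^ a * k) ` ({..N} \<times> ?A P)"
      using k(1) k0 by (intro image_eqI[of _ _ "(a, k)"]) auto
  qed
  have "(\<Sum>k\<in>?A (insert p P). 1 / real k) \<le> (\<Sum>k\<in>(\<lambda>(a, k). p ^ a * k) ` ({..N} \<times> ?A P). 1 / real k)"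
    by (intro sum_mono2 sub finite_imageI finite_cartesian_product fin) auto
  also have "\<dots> \<le> (\<Sum>x\<in>{..N} \<times> ?A P. 1 / real (case x of (a, k) \<Rightarrow> p ^ a * k))"
    using sum_image_le[of "{..N} \<times> ?A P" "\<lambda>k. 1 / real k" "\<lambda>(a, k). p ^ a * k"] fin
    by (auto simp: o_def)
  also have "\<dots> = (\<Sum>a\<le>N. (1 / real p) ^ a) * (\<Sum>k\<in>?A P. 1 / real k)"
    unfolding sum_product sum.cartesian_product by (intro sum.cong) (auto simp: power_divide)
  also have "\<dots> \<le> 1 / (1 - 1 / real p) * (\<Prod>p\<in>P. 1 / (1 - 1 / real p))"
  proof (intro mult_mono)
    have "(\<Sum>a\<le>N. (1 / real p) ^ a) \<le> (\<Sum>a. (1 / real p) ^ a)"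
      using p by (intro sum_le_suminf summable_geometric) auto
    also have "\<dots> = 1 / (1 - 1 / real p)" using p by (intro suminf_geometric) auto
    finally show "(\<Sum>a\<le>N. (1 / real p) ^ a) \<le> 1 / (1 - 1 / real p)" .
    show "(\<Sum>k\<in>?A P. 1 / real k) \<le> (\<Prod>p\<in>P. 1 / (1 - 1 / real p))"
      using insert by auto
  qed (use p in \<open>auto intro!: sum_nonneg\<close>)
  finally show ?case using insert.hyps by simp
qed

text \<open>All prime factors of a number up to \<open>N\<close> are at most \<open>N\<close>, so
  the Euler product over these primes dominates the harmonic sum. For \<open>p \<ge> 2\<close> each
  Euler factor is at most \<open>1 + 2 / p\<close>.\<close>

lemma harm_le_exp_sum_reciprocal_primes:
  "harm N \<le> exp (2 * (\<Sum>p | prime p \<and> p \<le> N. 1 / real p))"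
proof -
  let ?P = "{p::nat. prime p \<and> p \<le> N}"
  have fin: "finite ?P" by auto
  have "(harm N :: real) = (\<Sum>k | k \<in> {1..N} \<and> prime_factors k \<subseteq> ?P. 1 / real k)"
    unfolding harm_def
    by (intro sum.cong) (auto simp: divide_inverse in_prime_factors_iff dest!: dvd_imp_le)
  also have "\<dots> \<le> (\<Prod>p\<in>?P. 1 / (1 - 1 / real p))"
    by (intro sum_reciprocals_smooth_le) auto
  also have "\<dots> \<le> (\<Prod>p\<in>?P. exp (2 * (1 / real p)))"
  proof (intro prod_mono conjI)
    fix p assume "p \<in> ?P"
    then have "p \<ge> 2" by (auto simp: prime_ge_2_nat)
    then have p: "real p \<ge> 2" by simp
    then show "0 \<le> 1 / (1 - 1 / real p)" by (simp add: field_simps)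
    have "1 / (1 - 1 / real p) \<le> 1 + 2 * (1 / real p)" using p by (simp add: field_simps)
    also have "\<dots> \<le> exp (2 * (1 / real p))" by (rule exp_ge_add_one_self)
    finally show "1 / (1 - 1 / real p) \<le> exp (2 * (1 / real p))" .
  qed
  also have "\<dots> = exp (2 * (\<Sum>p\<in>?P. 1 / real p))"
    using fin by (simp add: exp_sum[symmetric] sum_distrib_left)
  finally show ?thesis .
qed

text \<open>The harmonic numbers grow like the logarithm, so the sum over primes up to
  \<open>N\<close> is unbounded, and discarding the primes up to \<open>L\<close> costs only the
  constant \<open>c\<close>. The freedom in \<open>L\<close> later keeps the singular densities
  small.\<close>

lemma sum_reciprocal_primes_unbounded:
  fixes L :: nat and K :: real
  obtains P :: "nat set" where "finite P" "\<And>p. p \<in> P \<Longrightarrow> prime p" "\<And>p. p \<in> P \<Longrightarrow> p > L"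
    "(\<Sum>p\<in>P. 1 / real p) \<ge> K"
proof -
  define c where "c = (\<Sum>p | prime p \<and> p \<le> L. 1 / real p)"
  \<comment> \<open>One exponential is undone by the logarithmic growth of \<open>harm N\<close>,
    the other by the exponential in the preceding bound.\<close>
  obtain N where N: "real N \<ge> exp (exp (2 * (K + c)))"
    using real_arch_simple by blast
  have N1: "real N > 0" using N by (smt (verit) exp_gt_zero)
  have "exp (2 * (K + c)) \<le> ln (real N)" using N N1 by (metis exp_gt_zero ln_exp ln_mono)
  also have "\<dots> \<le> ln (real N + 1)" using N1 by simp
  also have "\<dots> \<le> harm N" by (rule ln_le_harm)
  also have "\<dots> \<le> exp (2 * (\<Sum>p | prime p \<and> p \<le> N. 1 / real p))"
    by (rule harm_le_exp_sum_reciprocal_primes)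
  finally have *: "K + c \<le> (\<Sum>p | prime p \<and> p \<le> N. 1 / real p)" by simp
  have "(\<Sum>p | prime p \<and> p \<le> N. 1 / real p) \<le> (\<Sum>p\<in>{p. prime p \<and> p \<le> L} \<union> {p. prime p \<and> L < p \<and> p \<le> N}. 1 / real p)"
    by (intro sum_mono2) auto
  also have "\<dots> = c + (\<Sum>p | prime p \<and> L < p \<and> p \<le> N. 1 / real p)"
    unfolding c_def by (intro sum.union_disjoint) auto
  finally have "(\<Sum>p | prime p \<and> L < p \<and> p \<le> N. 1 / real p) \<ge> K" using * by simp
  then show ?thesis by (intro that[of "{p. prime p \<and> L < p \<and> p \<le> N}"]) auto
qed

section \<open>Integer matrices modulo \<open>q\<close>\<close>

lemma
  fixes S :: "'n::finite \<Rightarrow> 'a set"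
  assumes "\<And>i. finite (S i)"
  shows finite_vec_set: "finite {v :: 'a^'n. \<forall>i. v $ i \<in> S i}"
    and card_vec_set: "card {v :: 'a^'n. \<forall>i. v $ i \<in> S i} = (\<Prod>i\<in>UNIV. card (S i))"
proof -
  have bij: "bij_betw vec_nth {v :: 'a^'n. \<forall>i. v $ i \<in> S i} (PiE UNIV S)"
    by (rule bij_betwI[where g = vec_lambda]) auto
  have "finite (PiE UNIV S)" using assms by (intro finite_PiE) auto
  then show "finite {v :: 'a^'n. \<forall>i. v $ i \<in> S i}"
    using bij by (simp add: bij_betw_finite)
  show "card {v :: 'a^'n. \<forall>i. v $ i \<in> S i} = (\<Prod>i\<in>UNIV. card (S i))"
    using bij_betw_same_card[OF bij] by (simp add: card_PiE)
qed

lemma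
  fixes S :: "'a set"
  assumes "finite S"
  shows finite_mat_set: "finite {A :: 'a^'n^'n. \<forall>i j. A $ i $ j \<in> S}"
    and card_mat_set: "card {A :: 'a^'n::finite^'n. \<forall>i j. A $ i $ j \<in> S} = card S ^ CARD('n)\<^sup>2"
proof -
  have fin: "finite {v :: 'a^'n. \<forall>j. v $ j \<in> S}" using assms by (rule finite_vec_set)
  then show "finite {A :: 'a^'n^'n. \<forall>i j. A $ i $ j \<in> S}"
    using finite_vec_set[of "\<lambda>_::'n. {v :: 'a^'n. \<forall>j. v $ j \<in> S}"] by simp
  have "card {A :: 'a^'n^'n. \<forall>i j. A $ i $ j \<in> S} = card {v :: 'a^'n. \<forall>j. v $ j \<in> S} ^ CARD('n)"
    using card_vec_set[of "\<lambda>_::'n. {v :: 'a^'n. \<forall>j. v $ j \<in> S}"] fin by simp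
  also have "card {v :: 'a^'n. \<forall>j. v $ j \<in> S} = card S ^ CARD('n)"
    using card_vec_set[of "\<lambda>_::'n. S"] assms by simp
  finally show "card {A :: 'a^'n^'n. \<forall>i j. A $ i $ j \<in> S} = card S ^ CARD('n)\<^sup>2"
    by (simp add: power2_eq_square power_mult)
qed

lemma finite_bounded_mats: "finite (bounded_mats H :: (int^'n::finite^'n) set)"
proof -
  have "bounded_mats H = {A :: int^'n^'n. \<forall>i j. A $ i $ j \<in> {- int H..int H}}"
    unfolding bounded_mats_def by (auto simp: abs_le_iff) (smt (verit))+
  then show ?thesis by (simp only: finite_mat_set finite_atLeastAtMost_int)
qed

section \<open>Recursion and size bounds for the product set\<close>

lemma W_set_0: "W_set 0 H = {mat 1}"
  by (auto simp: W_set_def mat_list_prod_def)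

text \<open>Peeling off the leftmost factor is the basis of every induction on the number of
  factors.\<close>

lemma W_set_Suc: "W_set (Suc m) H = (\<lambda>(A, B). A ** B) ` (bounded_mats H \<times> W_set m H)"
proof (intro equalityI subsetI)
  fix B :: "int^'a^'a" assume "B \<in> W_set (Suc m) H"
  then obtain As where As: "B = mat_list_prod As" "length As = Suc m" "set As \<subseteq> bounded_mats H"
    by (auto simp: W_set_def)
  then obtain A As' where "As = A # As'" by (cases As) auto
  with As show "B \<in> (\<lambda>(A, B). A ** B) ` (bounded_mats H \<times> W_set m H)"
    by (intro image_eqI[of _ _ "(A, mat_list_prod As')"]) (auto simp: W_set_def mat_list_prod_def)
next
  fix B :: "int^'a^'a" assume "B \<in> (\<lambda>(A, B). A ** B) ` (bounded_mats H \<times> W_set m H)"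
  then obtain A As where "B = A ** mat_list_prod As" "length As = m" "set As \<subseteq> bounded_mats H"
    "A \<in> bounded_mats H" by (auto simp: W_set_def)
  then show "B \<in> W_set (Suc m) H" unfolding W_set_def
    by (intro CollectI exI[of _ "A # As"]) (auto simp: mat_list_prod_def)
qed

lemma finite_W_set: "finite (W_set m H)"
  by (induction m) (auto simp: W_set_0 W_set_Suc finite_bounded_mats)

lemma bounded_mats_mult:
  assumes "A \<in> bounded_mats H" "B \<in> bounded_mats K"
  shows "(A :: int^'n::finite^'n) ** B \<in> bounded_mats (CARD('n) * H * K)"
  unfolding bounded_mats_def
proof (intro CollectI allI)
  fix i j
  have "\<bar>(A ** B) $ i $ j\<bar> \<le> (\<Sum>k\<in>UNIV. \<bar>A $ i $ k * B $ k $ j\<bar>)"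
    unfolding matrix_matrix_mult_def by (simp add: sum_abs)
  also have "\<dots> \<le> (\<Sum>k\<in>(UNIV::'n set). int H * int K)"
    using assms unfolding bounded_mats_def abs_mult by (intro sum_mono mult_mono) auto
  finally show "\<bar>(A ** B) $ i $ j\<bar> \<le> int (CARD('n) * H * K)" by simp
qed

text \<open>Every further factor enlarges the entries by at most \<open>CARD('n) * H\<close>. The
  resulting box has the same order of magnitude \<open>H ^ (m * CARD('n)\<^sup>2)\<close> as the
  number of tuples of factors.\<close>

lemma W_set_subset_bounded_mats:
  "(W_set m H :: (int^'n::finite^'n) set) \<subseteq> bounded_mats ((CARD('n) * H) ^ m)"
proof (induction m)
  case 0
  then show ?case by (auto simp: W_set_0 bounded_mats_def mat_def)
next
  case (Suc m)
  show ?case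
  proof
    fix B :: "int^'n^'n" assume "B \<in> W_set (Suc m) H"
    then obtain A C where "B = A ** C" "A \<in> bounded_mats H" "C \<in> W_set m H"
      by (auto simp: W_set_Suc)
    then show "B \<in> bounded_mats ((CARD('n) * H) ^ Suc m)"
      using bounded_mats_mult[of A H C "(CARD('n) * H) ^ m"] Suc by auto
  qed
qed

section \<open>Congruence and singularity of matrices modulo \<open>q\<close>\<close>

definition mat_cong :: "nat \<Rightarrow> int^'n^'n \<Rightarrow> int^'n^'n \<Rightarrow> bool" where
  "mat_cong q A B \<longleftrightarrow> (\<forall>i j. [A $ i $ j = B $ i $ j] (mod int q))"

definition mat_mod :: "nat \<Rightarrow> int^'n^'n \<Rightarrow> int^'n^'n" where
  "mat_mod q A = (\<chi> i j. A $ i $ j mod int q)"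

definition residue_mats :: "nat \<Rightarrow> (int^'n^'n) set" where
  "residue_mats q = {A. \<forall>i j. A $ i $ j \<in> {0..<int q}}"

text \<open>For prime \<open>q\<close> this is the vanishing of the determinant modulo
  \<open>q\<close>. The formulation with a kernel vector reduces the behaviour under products to
  injectivity and surjectivity, without determinants.\<close>

definition singular_mod :: "nat \<Rightarrow> int^'n^'n \<Rightarrow> bool" where
  "singular_mod q A \<longleftrightarrow> (\<exists>v. (\<exists>j. \<not> int q dvd v $ j) \<and> (\<forall>i. int q dvd (A *v v) $ i))"

lemma finite_residue_mats: "finite (residue_mats q)"
  unfolding residue_mats_def by (rule finite_mat_set) auto

lemma card_residue_mats: "card (residue_mats q :: (int^'n::finite^'n) set) = q ^ CARD('n)\<^sup>2"
  unfolding residue_mats_def by (subst card_mat_set) auto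

lemma mat_mod_in_residue_mats: "q > 0 \<Longrightarrow> mat_mod q A \<in> residue_mats q"
  by (simp add: mat_mod_def residue_mats_def)

lemma mat_cong_mat_mod: "mat_cong q (mat_mod q A) A"
  by (simp add: mat_mod_def mat_cong_def)

lemma mat_cong_sym: "mat_cong q A B \<Longrightarrow> mat_cong q B A"
  by (simp add: mat_cong_def cong_sym_eq)

lemma mat_cong_dvd: "mat_cong q A B \<Longrightarrow> p dvd q \<Longrightarrow> mat_cong p A B"
  unfolding mat_cong_def by (meson cong_dvd_modulus of_nat_dvd_iff)

lemma mat_cong_mult_right:
  assumes "mat_cong q A B"
  shows "mat_cong q (A ** C) (B ** C)"
  using assms unfolding mat_cong_def matrix_matrix_mult_def
  by (auto intro!: cong_sum cong_mult)

lemma singular_mod_cong_imp: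
  assumes "mat_cong q A B" "singular_mod q A"
  shows "singular_mod q B"
proof -
  obtain v j where v: "\<not> int q dvd v $ j" "\<And>i. int q dvd (A *v v) $ i"
    using assms(2) by (auto simp: singular_mod_def)
  have "[(A *v v) $ i = (B *v v) $ i] (mod int q)" for i
    using assms(1) unfolding mat_cong_def matrix_vector_mult_def
    by (auto intro!: cong_sum cong_mult)
  then have "int q dvd (B *v v) $ i" for i using v(2) cong_dvd_iff by blast
  with v(1) show ?thesis unfolding singular_mod_def by blast
qed

lemma singular_mod_cong: "mat_cong q A B \<Longrightarrow> singular_mod q A \<longleftrightarrow> singular_mod q B"
  using singular_mod_cong_imp mat_cong_sym by blast

text \<open>An injective self-map of the finite set of vectors modulo \<open>q\<close> is surjective.\<close>

lemma not_singular_mod_imp_surj: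
  fixes A :: "int^'n::finite^'n"
  assumes "q > 0" "\<not> singular_mod q A"
  obtains v where "\<And>i. [(A *v v) $ i = w $ i] (mod int q)"
proof -
  let ?V = "{v :: int^'n. \<forall>i. v $ i \<in> {0..<int q}}"
  let ?f = "\<lambda>v. (\<chi> i. (A *v v) $ i mod int q) :: int^'n"
  have "finite ?V" by (rule finite_vec_set) auto
  moreover have "?f ` ?V \<subseteq> ?V" using assms(1) by auto
  moreover have "inj_on ?f ?V"
  proof (rule inj_onI)
    fix v w assume vw: "v \<in> ?V" "w \<in> ?V" "?f v = ?f w"
    have "int q dvd (A *v (v - w)) $ i" for i
      using vw(3) by (auto simp: vec_eq_iff matrix_vector_mult_diff_distrib mod_eq_dvd_iff)
    then have "int q dvd (v - w) $ j" for j
      using assms(2) unfolding singular_mod_def by blast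
    then have "v $ j mod int q = w $ j mod int q" for j
      by (simp add: mod_eq_dvd_iff)
    then show "v = w" using vw(1,2) by (simp add: vec_eq_iff)
  qed
  ultimately have "?f ` ?V = ?V" by (intro endo_inj_surj)
  moreover have "(\<chi> i. w $ i mod int q) \<in> ?V" using assms(1) by auto
  ultimately obtain v where "?f v = (\<chi> i. w $ i mod int q)" by (metis (no_types, lifting) imageE)
  then have "[(A *v v) $ i = w $ i] (mod int q)" for i by (simp add: vec_eq_iff cong_def)
  then show ?thesis by (rule that)
qed

text \<open>A kernel vector \<open>v\<close> of the product is either killed by \<open>B\<close> or
  gives the kernel vector \<open>B *v v\<close> of \<open>A\<close>. Conversely, if \<open>B\<close>
  is not singular, it is surjective modulo \<open>q\<close>, and a kernel vector of \<open>A\<close>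
  lifts through \<open>B\<close>.\<close>

lemma singular_mod_mult_iff:
  fixes A B :: "int^'n::finite^'n"
  assumes "q > 0"
  shows "singular_mod q (A ** B) \<longleftrightarrow> singular_mod q A \<or> singular_mod q B"
proof
  assume "singular_mod q (A ** B)"
  then obtain v j where v: "\<not> int q dvd v $ j" "\<And>i. int q dvd (A *v (B *v v)) $ i"
    by (auto simp: singular_mod_def matrix_vector_mul_assoc)
  show "singular_mod q A \<or> singular_mod q B"
    using v unfolding singular_mod_def by metis
next
  assume *: "singular_mod q A \<or> singular_mod q B"
  show "singular_mod q (A ** B)"
  proof (cases "singular_mod q B")
    case True
    then obtain v j where v: "\<not> int q dvd v $ j" "\<And>i. int q dvd (B *v v) $ i"
      by (auto simp: singular_mod_def)
    have "int q dvd (A *v (B *v v)) $ i" for i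
      unfolding matrix_vector_mult_def[of A] using v(2) by (auto intro!: dvd_sum)
    with v(1) show ?thesis unfolding singular_mod_def by (metis matrix_vector_mul_assoc)
  next
    case False
    with * obtain w j where w: "\<not> int q dvd w $ j" "\<And>i. int q dvd (A *v w) $ i"
      by (auto simp: singular_mod_def)
    obtain v where v: "\<And>i. [(B *v v) $ i = w $ i] (mod int q)"
      using not_singular_mod_imp_surj[OF assms False] by blast
    have "[(A *v (B *v v)) $ i = (A *v w) $ i] (mod int q)" for i
      unfolding matrix_vector_mult_def[of A] using v by (auto intro!: cong_sum cong_mult)
    then have 1: "int q dvd (A *v (B *v v)) $ i" for i using w(2) cong_dvd_iff by blast
    \<comment> \<open>The lift is nonzero modulo \<open>q\<close>, since otherwise its image
      \<open>w\<close> would vanish too.\<close>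
    have "\<exists>j. \<not> int q dvd v $ j"
    proof (rule ccontr)
      assume "\<not> (\<exists>j. \<not> int q dvd v $ j)"
      then have "int q dvd (B *v v) $ j"
        unfolding matrix_vector_mult_def by (auto intro!: dvd_sum)
      with v[of j] w(1) show False using cong_dvd_iff by blast
    qed
    with 1 show ?thesis unfolding singular_mod_def by (metis matrix_vector_mul_assoc)
  qed
qed

lemma not_singular_mod_mat_1: "\<not> singular_mod q (mat 1)"
  by (auto simp: singular_mod_def)

section \<open>Independence of different primes, and passage from boxes to residues\<close>

text \<open>The Chinese remainder theorem, applied to every entry, identifies
  \<open>residue_mats (a * b)\<close> with the product of the two residue sets. In terms of means,
  functions of the residues modulo \<open>a\<close> and modulo \<open>b\<close> are
  independent.\<close>

lemma sum_residue_mats_mult: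
  fixes f g :: "int^'n::finite^'n \<Rightarrow> real"
  assumes "coprime a b" "a > 0" "b > 0"
    and f: "\<And>A B. mat_cong a A B \<Longrightarrow> f A = f B"
    and g: "\<And>A B. mat_cong b A B \<Longrightarrow> g A = g B"
  shows "(\<Sum>A\<in>residue_mats (a * b). f A * g A) = (\<Sum>A\<in>residue_mats a. f A) * (\<Sum>A\<in>residue_mats b. g A)"
proof -
  let ?h = "\<lambda>A :: int^'n^'n. (mat_mod a A, mat_mod b A)"
  have inj: "inj_on ?h (residue_mats (a * b))"
  proof (rule inj_onI)
    fix A B :: "int^'n^'n"
    assume AB: "A \<in> residue_mats (a * b)" "B \<in> residue_mats (a * b)" "?h A = ?h B"
    have "A $ i $ j = B $ i $ j" for i j
    proof -
      have "[A $ i $ j = B $ i $ j] (mod int a)" "[A $ i $ j = B $ i $ j] (mod int b)"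
        using AB(3) by (auto simp: mat_mod_def vec_eq_iff cong_def)
      then have "[A $ i $ j = B $ i $ j] (mod (int a * int b))"
        using assms(1) by (intro coprime_cong_mult) auto
      then show ?thesis using AB(1,2) by (auto simp: residue_mats_def cong_def)
    qed
    then show "A = B" by (simp add: vec_eq_iff)
  qed
  \<comment> \<open>Surjectivity comes from counting: the map is injective and both sides have the
    same finite cardinality.\<close>
  have "?h ` residue_mats (a * b) = residue_mats a \<times> residue_mats b"
  proof (rule card_subset_eq)
    show "?h ` residue_mats (a * b) \<subseteq> residue_mats a \<times> residue_mats b"
      using assms mat_mod_in_residue_mats by auto
    show "card (?h ` residue_mats (a * b)) = card (residue_mats a \<times> residue_mats b :: ((int^'n^'n) \<times> (int^'n^'n)) set)"
      using inj by (simp add: card_image card_cartesian_product card_residue_mats power_mult_distrib)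
  qed (auto simp: finite_residue_mats)
  then have "(\<Sum>x\<in>residue_mats a \<times> residue_mats b. f (fst x) * g (snd x)) = (\<Sum>A\<in>residue_mats (a * b). f (mat_mod a A) * g (mat_mod b A))"
    using sum.reindex[OF inj, of "\<lambda>x. f (fst x) * g (snd x)"] by simp
  also have "\<dots> = (\<Sum>A\<in>residue_mats (a * b). f A * g A)"
    using f[OF mat_cong_mat_mod] g[OF mat_cong_mat_mod] by simp
  finally show ?thesis by (simp add: sum_product sum.cartesian_product case_prod_beta)
qed

lemma sum_residue_mats_prod:
  fixes f :: "nat \<Rightarrow> int^'n::finite^'n \<Rightarrow> real"
  assumes "finite P" "\<And>p. p \<in> P \<Longrightarrow> prime p"
    and f: "\<And>p A B. p \<in> P \<Longrightarrow> mat_cong p A B \<Longrightarrow> f p A = f p B"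
  shows "(\<Sum>A\<in>residue_mats (\<Prod>P). \<Prod>p\<in>P. f p A) = (\<Prod>p\<in>P. \<Sum>A\<in>residue_mats p. f p A)"
  using assms
proof (induction P rule: finite_induct)
  case empty
  then show ?case by (simp add: card_residue_mats)
next
  case (insert p P)
  have "(\<Sum>A\<in>residue_mats (p * \<Prod>P). f p A * (\<Prod>p\<in>P. f p A)) = (\<Sum>A\<in>residue_mats p. f p A) * (\<Sum>A\<in>residue_mats (\<Prod>P). \<Prod>p\<in>P. f p A)"
  proof (rule sum_residue_mats_mult)
    have "coprime p q" if "q \<in> P" for q
      using insert that by (metis insertI1 insertI2 primes_coprime)
    then show "coprime p (\<Prod>P)" by (intro prod_coprime_right) auto
    show "p > 0" using insert.prems by (auto simp: prime_gt_0_nat)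
    show "\<Prod>P > 0" using insert.prems by (auto intro!: prod_pos simp: prime_gt_0_nat)
    show "mat_cong p A B \<Longrightarrow> f p A = f p B" for A B using insert.prems by auto
    show "(\<Prod>p\<in>P. f p A) = (\<Prod>p\<in>P. f p B)" if "mat_cong (\<Prod>P) A B" for A B
      using insert that by (intro prod.cong refl insert.prems(2)) (auto intro: mat_cong_dvd dvd_prodI)
  qed
  then show ?case using insert by auto
qed

text \<open>Division with remainder writes each entry as a residue and a quotient. \<open>F\<close>
  depends on the residues alone, and the number of possible quotients is bounded, so the sum over
  the box is at most a constant power times its size times the mean over residues.\<close>

lemma sum_bounded_mats_le:
  fixes F :: "int^'n::finite^'n \<Rightarrow> real"
  assumes Q: "Q > 0" "Q \<le> X"
    and F: "\<And>A B. mat_cong Q A B \<Longrightarrow> F A = F B" "\<And>A. F A \<ge> 0"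
  shows "(\<Sum>A\<in>bounded_mats X. F A) \<le> (4 * real X) ^ CARD('n)\<^sup>2 * ((\<Sum>A\<in>residue_mats Q. F A) / real Q ^ CARD('n)\<^sup>2)"
proof -
  let ?I = "{(- int X) div int Q..int X div int Q}"
  let ?D = "{D :: int^'n^'n. \<forall>i j. D $ i $ j \<in> ?I}"
  let ?h = "\<lambda>A :: int^'n^'n. (mat_mod Q A, (\<chi> i j. A $ i $ j div int Q) :: int^'n^'n)"
  have finD: "finite ?D" by (rule finite_mat_set) auto
  have inj: "inj_on ?h (bounded_mats X)"
  proof (rule inj_onI)
    fix A B :: "int^'n^'n" assume "?h A = ?h B"
    then have "A $ i $ j mod int Q = B $ i $ j mod int Q" "A $ i $ j div int Q = B $ i $ j div int Q" for i j
      by (auto simp: vec_eq_iff mat_mod_def)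
    then have "A $ i $ j = B $ i $ j" for i j by (metis div_mult_mod_eq)
    then show "A = B" by (simp add: vec_eq_iff)
  qed
  have sub: "?h ` bounded_mats X \<subseteq> residue_mats Q \<times> ?D"
  proof -
    have "A $ i $ j div int Q \<in> ?I" if "A \<in> bounded_mats X" for A :: "int^'n^'n" and i j
    proof -
      have "- int X \<le> A $ i $ j" "A $ i $ j \<le> int X" using that by (auto simp: bounded_mats_def abs_le_iff) (smt (verit))
      then show ?thesis using Q by (auto intro!: zdiv_mono1)
    qed
    then show ?thesis using Q mat_mod_in_residue_mats by auto
  qed
  \<comment> \<open>The interval has at most \<open>2 * X / Q + 2\<close> elements, and
    \<open>Q \<le> X\<close> absorbs the 2 into another \<open>2 * X / Q\<close>.\<close>
  have cardI: "real (card ?I) \<le> 4 * real X / real Q"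
  proof -
    have 1: "real_of_int (int X div int Q) \<le> real X / real Q"
      using real_of_int_div4[of "int X" "int Q"] by simp
    have "- real X / real Q - 1 \<le> real_of_int (- int X div int Q)"
      using real_of_int_div3[of "- int X" "int Q"] by simp
    moreover have "real X / real Q \<ge> 1" using Q by simp
    moreover have "- int X div int Q \<le> int X div int Q" using Q by (intro zdiv_mono1) auto
    ultimately show ?thesis using 1 by simp
  qed
  have "(\<Sum>A\<in>bounded_mats X. F A) = (\<Sum>A\<in>bounded_mats X. F (fst (?h A)))"
    using F(1)[OF mat_cong_mat_mod] by simp
  also have "\<dots> = (\<Sum>x\<in>?h ` bounded_mats X. F (fst x))"
    using sum.reindex[OF inj, of "\<lambda>x. F (fst x)"] by simp
  also have "\<dots> \<le> (\<Sum>x\<in>residue_mats Q \<times> ?D. F (fst x))"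
    using sub finD F(2) by (intro sum_mono2) (auto simp: finite_residue_mats)
  also have "\<dots> = (\<Sum>A\<in>residue_mats Q. \<Sum>D\<in>?D. F A)"
    unfolding sum.cartesian_product by (rule sum.cong) auto
  also have "\<dots> = real (card ?D) * (\<Sum>A\<in>residue_mats Q. F A)"
    by (simp only: sum_constant sum_distrib_left)
  also have "real (card ?D) = real (card ?I) ^ CARD('n)\<^sup>2"
    by (subst card_mat_set) auto
  also have "real (card ?I) ^ CARD('n)\<^sup>2 * (\<Sum>A\<in>residue_mats Q. F A)
      \<le> (4 * real X / real Q) ^ CARD('n)\<^sup>2 * (\<Sum>A\<in>residue_mats Q. F A)"
    using cardI F(2) by (intro mult_right_mono power_mono sum_nonneg) auto
  finally show ?thesis by (simp add: power_divide)
qed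

section \<open>The lower bound\<close>

lemma card_le_mult_card_image:
  assumes "finite X" "\<And>y. y \<in> f ` X \<Longrightarrow> card {x \<in> X. f x = y} \<le> T"
  shows "card X \<le> T * card (f ` X)"
proof -
  have "card X = (\<Sum>y\<in>f ` X. card {x \<in> X. f x = y})"
    using assms(1) by (subst card_UN_disjoint[symmetric]) (auto intro: arg_cong[where f = card])
  also have "\<dots> \<le> (\<Sum>y\<in>f ` X. T)" using assms(2) by (rule sum_mono)
  finally show ?thesis by (simp add: mult.commute)
qed

lemma row_scaling_eq_mult:
  fixes d :: "int^'n::finite" and B :: "int^'n^'n"
  shows "(\<chi> i j. d $ i * B $ i $ j) = (\<chi> i j. if i = j then d $ i else 0) ** B"
proof -
  have "(\<Sum>k\<in>UNIV. (if i = k then d $ i else 0) * B $ k $ j) = (\<Sum>k\<in>UNIV. if k = i then d $ i * B $ i $ j else 0)" for i j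
    by (rule sum.cong) auto
  then show ?thesis by (simp add: vec_eq_iff matrix_matrix_mult_def)
qed

text \<open>Each step multiplies the matrices in \<open>V\<close> from the left by all diagonal
  matrices with entries in \<open>{1..H}\<close>. A fibre of this map loses at most
  \<open>T ^ CARD('n)\<close>, because the diagonal entry \<open>d $ i\<close> divides the entries
  of row \<open>i\<close> of the product. Positivity makes these entries nonzero, and their upper
  bound keeps them in the range where \<open>T\<close> bounds the number of divisors.\<close>

lemma W_set_positive_subset_card_ge:
  fixes H T M :: nat
  assumes "H > 0" "k < M"
    and T: "\<And>N. 0 < N \<Longrightarrow> N \<le> H ^ M \<Longrightarrow> card {d. d dvd N} \<le> T"
  shows "\<exists>V \<subseteq> (W_set (Suc k) H :: (int^'n::finite^'n) set).
    (\<forall>A\<in>V. \<forall>i j. A $ i $ j \<in> {1..int H ^ Suc k}) \<and> H ^ (CARD('n)\<^sup>2 + k * CARD('n)) \<le> (T ^ CARD('n)) ^ k * card V"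
  using \<open>k < M\<close>
proof (induction k)
  case 0
  let ?V = "{A :: int^'n^'n. \<forall>i j. A $ i $ j \<in> {1..int H}}"
  have "?V \<subseteq> W_set 1 H"
  proof
    fix A assume "A \<in> ?V"
    then have "A \<in> bounded_mats H" by (auto simp: bounded_mats_def) (smt (verit))
    then show "A \<in> W_set 1 H"
      using W_set_Suc[of 0 H] by (auto simp: W_set_0 intro!: image_eqI[of _ _ "(A, mat 1)"])
  qed
  moreover have "card ?V = H ^ CARD('n)\<^sup>2" by (subst card_mat_set) auto
  ultimately show ?case by (intro exI[of _ ?V]) auto
next
  case (Suc k)
  then obtain V where V: "V \<subseteq> (W_set (Suc k) H :: (int^'n^'n) set)"
    "\<And>A i j. A \<in> V \<Longrightarrow> A $ i $ j \<in> {1..int H ^ Suc k}"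
    "H ^ (CARD('n)\<^sup>2 + k * CARD('n)) \<le> (T ^ CARD('n)) ^ k * card V"
    by fastforce
  let ?D = "{d :: int^'n. \<forall>i. d $ i \<in> {1..int H}}"
  let ?f = "\<lambda>(d :: int^'n, B :: int^'n^'n). (\<chi> i j. d $ i * B $ i $ j) :: int^'n^'n"
  have finD: "finite ?D" by (rule finite_vec_set) auto
  have cardD: "card ?D = H ^ CARD('n)" by (subst card_vec_set) auto
  have finV: "finite V" using V(1) finite_W_set finite_subset by blast
  let ?V' = "?f ` (?D \<times> V)"
  have "?V' \<subseteq> W_set (Suc (Suc k)) H"
  proof
    fix C assume "C \<in> ?V'"
    then obtain d B where dB: "d \<in> ?D" "B \<in> V" "C = ?f (d, B)" by blast
    let ?A = "(\<chi> i j. if i = j then d $ i else 0) :: int^'n^'n"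
    have "?A \<in> bounded_mats H" using dB(1) by (auto simp: bounded_mats_def) (smt (verit))
    moreover have "C = ?A ** B" using dB(3) row_scaling_eq_mult by simp
    ultimately show "C \<in> W_set (Suc (Suc k)) H"
      unfolding W_set_Suc[of "Suc k"] using dB(2) V(1) by (intro image_eqI[of _ _ "(?A, B)"]) auto
  qed
  moreover have entries: "C $ i $ j \<in> {1..int H ^ Suc (Suc k)}" if C: "C \<in> ?V'" for C i j
  proof -
    obtain d B where dB: "d \<in> ?D" "B \<in> V" "C = ?f (d, B)" using C by blast
    have "1 \<le> d $ i" "d $ i \<le> int H" "1 \<le> B $ i $ j" "B $ i $ j \<le> int H ^ Suc k"
      using dB(1) V(2)[OF dB(2), of i j] by auto
    then have "1 * 1 \<le> d $ i * B $ i $ j" "d $ i * B $ i $ j \<le> int H * int H ^ Suc k"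
      by (intro mult_mono; simp)+
    then show ?thesis using dB(3) by simp
  qed
  moreover have "card (?D \<times> V) \<le> T ^ CARD('n) * card ?V'"
  proof (rule card_le_mult_card_image)
    show "finite (?D \<times> V)" using finD finV by simp
    fix C assume C: "C \<in> ?V'"
    \<comment> \<open>Any column will do, since all entries of \<open>C\<close> are
      positive.\<close>
    obtain j :: 'n where True by blast
    let ?S = "\<lambda>i. int ` {d. d dvd nat (C $ i $ j)}"
    let ?X = "{x \<in> ?D \<times> V. ?f x = C}"
    have pos: "C $ i $ j \<ge> 1" "C $ i $ j \<le> int H ^ Suc (Suc k)" for i using entries[OF C, of i j] by auto
    have finS: "finite (?S i)" for i using pos[of i] by auto
    \<comment> \<open>For a given product the diagonal determines the other factor by cancellation,
      so it is enough to count the diagonals.\<close>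
    have "inj_on fst ?X"
    proof (rule inj_onI)
      fix x y assume "x \<in> ?X" "y \<in> ?X" and eq: "fst x = fst y"
      then have x: "fst x \<in> ?D" "\<And>i j. fst x $ i * snd x $ i $ j = C $ i $ j"
        "\<And>i j. fst y $ i * snd y $ i $ j = C $ i $ j"
        by (auto simp: case_prod_beta vec_eq_iff)
      have "snd x $ i $ j = snd y $ i $ j" for i j
      proof -
        have "fst x $ i \<ge> 1" using x(1) by auto
        moreover have "fst x $ i * snd x $ i $ j = fst x $ i * snd y $ i $ j"
          using x(2,3)[of i j] eq by simp
        ultimately show ?thesis by auto
      qed
      then show "x = y" using eq by (simp add: prod_eq_iff vec_eq_iff)
    qed
    then have "card ?X = card (fst ` ?X)" by (simp add: card_image)
    also have "\<dots> \<le> card {d :: int^'n. \<forall>i. d $ i \<in> ?S i}"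
    proof (rule card_mono)
      show "finite {d :: int^'n. \<forall>i. d $ i \<in> ?S i}" using finS by (rule finite_vec_set)
      show "fst ` ?X \<subseteq> {d. \<forall>i. d $ i \<in> ?S i}"
      proof (intro subsetI CollectI allI)
        fix d and i assume "d \<in> fst ` ?X"
        then obtain B where dD: "d \<in> ?D" and CB: "?f (d, B) = C" by auto
        then have d: "\<forall>i. 1 \<le> d $ i" by auto
        have "C $ i $ j = d $ i * B $ i $ j" using CB by (auto simp: vec_eq_iff)
        then have eq: "nat (C $ i $ j) = nat (d $ i) * nat (B $ i $ j)"
          using d by (metis nat_mult_distrib order_trans zero_le_one)
        have "d $ i \<ge> 0" using d by (meson order_trans zero_le_one)
        then show "d $ i \<in> ?S i"
          using eq by (intro image_eqI[of _ _ "nat (d $ i)"]) auto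
      qed
    qed
    also have "\<dots> = (\<Prod>i\<in>UNIV. card (?S i))" using finS by (rule card_vec_set)
    also have "\<dots> \<le> (\<Prod>i\<in>(UNIV :: 'n set). T)"
    proof (intro prod_mono conjI)
      fix i :: 'n
      have "nat (C $ i $ j) \<le> H ^ Suc (Suc k)" using pos(2)[of i] by (simp add: nat_le_iff)
      also have "\<dots> \<le> H ^ M" using Suc.prems \<open>H > 0\<close> by (intro power_increasing) auto
      finally have "card {d. d dvd nat (C $ i $ j)} \<le> T" using pos(1)[of i] by (intro T) auto
      then show "card (?S i) \<le> T" by (simp add: card_image)
    qed auto
    finally show "card ?X \<le> T ^ CARD('n)" by simp
  qed
  then have "H ^ (CARD('n)\<^sup>2 + Suc k * CARD('n)) \<le> (T ^ CARD('n)) ^ Suc k * card ?V'"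
  proof -
    have "H ^ (CARD('n)\<^sup>2 + Suc k * CARD('n)) = H ^ CARD('n) * H ^ (CARD('n)\<^sup>2 + k * CARD('n))"
      by (simp add: power_add mult_ac)
    also have "\<dots> \<le> H ^ CARD('n) * ((T ^ CARD('n)) ^ k * card V)" using V(3) by simp
    also have "\<dots> = (T ^ CARD('n)) ^ k * card (?D \<times> V)" by (simp only: card_cartesian_product cardD mult_ac)
    also have "\<dots> \<le> (T ^ CARD('n)) ^ k * (T ^ CARD('n) * card ?V')"
      using \<open>card (?D \<times> V) \<le> _\<close> by (rule mult_left_mono) simp
    finally show ?thesis by (simp add: mult_ac)
  qed
  ultimately show ?case by (intro exI[of _ ?V'] conjI ballI allI)
qed

text \<open>With \<open>k = m - 1\<close> diagonal factors the preceding count has the exponent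
  \<open>n^2 + (m - 1) n\<close>. It remains to bound the loss \<open>T ^ (n * k)\<close> by
  \<open>H powr \<epsilon>\<close>, where \<open>T\<close> comes from the divisor bound.\<close>

lemma card_W_set_ge:
  fixes \<epsilon> :: real and m :: nat
  assumes "\<epsilon> > 0" "m > 0"
  shows "\<forall>\<^sub>F H in at_top. real (card (W_set m H :: (int^'n::finite^'n) set))
    \<ge> real H powr (real CARD('n) ^ 2 + real m * real CARD('n) - real CARD('n) - \<epsilon>)"
proof -
  let ?n = "CARD('n)"
  obtain k where k: "m = Suc k" using assms(2) gr0_implies_Suc by blast
  define N where "N = real (?n * k)"
  \<comment> \<open>The loss is at most \<open>(C * H powr (m * \<delta>)) powr N\<close>. This
    \<open>\<delta>\<close> makes \<open>m * \<delta> * N\<close> at most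
    \<open>\<epsilon> / 2\<close>, also when \<open>N = 0\<close>; the other half of
    \<open>\<epsilon>\<close> absorbs the constant \<open>C powr N\<close> for large
    \<open>H\<close>.\<close>
  define \<delta> where "\<delta> = \<epsilon> / (2 * (N + 1) * m)"
  have "N \<ge> 0" by (simp add: N_def)
  have \<delta>: "\<delta> > 0" using assms \<open>N \<ge> 0\<close> by (simp add: \<delta>_def)
  obtain C :: real where C: "C \<ge> 1" "\<And>N::nat. N > 0 \<Longrightarrow> real (card {d. d dvd N}) \<le> C * real N powr \<delta>"
    using divisor_bound[OF \<delta>] by blast
  have "\<forall>\<^sub>F H in at_top. real H powr (\<epsilon> / 2) \<ge> C powr N"
  proof -
    have "filterlim (\<lambda>H. real H powr (\<epsilon> / 2)) at_top at_top"
      using assms(1) by real_asymp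
    then show ?thesis by (simp add: filterlim_at_top)
  qed
  then show ?thesis using eventually_gt_at_top[of 0]
  proof eventually_elim
    case (elim H)
    let ?W = "W_set m H :: (int^'n^'n) set"
    define t where "t = C * real (H ^ m) powr \<delta>"
    have t0: "t \<ge> 0" using C(1) by (simp add: t_def)
    have "card {d. d dvd N} \<le> nat \<lfloor>t\<rfloor>" if "0 < N" "N \<le> H ^ m" for N
    proof -
      have "real (card {d. d dvd N}) \<le> C * real N powr \<delta>" using C(2) that by blast
      also have "\<dots> \<le> t" unfolding t_def using that C(1) \<delta>
        by (intro mult_left_mono powr_mono2) (auto simp flip: of_nat_power)
      finally show ?thesis by (simp add: le_nat_floor)
    qed
    then obtain V where V: "V \<subseteq> ?W" "H ^ (?n\<^sup>2 + k * ?n) \<le> (nat \<lfloor>t\<rfloor> ^ ?n) ^ k * card V"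
      using W_set_positive_subset_card_ge[of H k m "nat \<lfloor>t\<rfloor>", where ?'n = 'n] elim k by auto
    have "real H ^ (?n\<^sup>2 + k * ?n) \<le> real ((nat \<lfloor>t\<rfloor> ^ ?n) ^ k * card V)"
      using V(2) by (metis of_nat_le_iff of_nat_power)
    also have "\<dots> = real (nat \<lfloor>t\<rfloor>) ^ (?n * k) * real (card V)" by (simp add: power_mult)
    also have "\<dots> \<le> t ^ (?n * k) * real (card ?W)"
      using V(1) finite_W_set t0 by (intro mult_mono power_mono of_nat_mono card_mono) auto
    also have "t ^ (?n * k) \<le> real H powr \<epsilon>"
    proof -
      have "real (H ^ m) powr \<delta> = real H powr (m * \<delta>)"
        using elim by (simp add: powr_powr powr_realpow[symmetric])
      then have "t ^ (?n * k) = (C * real H powr (m * \<delta>)) powr N"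
        using C(1) elim unfolding t_def N_def by (subst powr_realpow) auto
      also have "\<dots> = C powr N * real H powr (m * \<delta> * N)"
        using C(1) by (simp add: powr_mult powr_powr)
      also have "\<dots> \<le> real H powr (\<epsilon> / 2) * real H powr (\<epsilon> / 2)"
      proof (intro mult_mono powr_mono)
        have "m * \<delta> * N = \<epsilon> / 2 * (N / (N + 1))"
          using assms(2) \<open>N \<ge> 0\<close> by (simp add: \<delta>_def divide_simps)
        also have "\<dots> \<le> \<epsilon> / 2 * 1" using assms \<open>N \<ge> 0\<close> by (intro mult_left_mono) auto
        finally show "m * \<delta> * N \<le> \<epsilon> / 2" by simp
      qed (use elim in auto)
      also have "\<dots> = real H powr \<epsilon>" by (simp add: powr_add[symmetric])
      finally show ?thesis .
    qed
    finally have "real H ^ (?n\<^sup>2 + k * ?n) \<le> real H powr \<epsilon> * real (card ?W)"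
      by (simp add: mult_right_mono)
    moreover have "real H ^ (?n\<^sup>2 + k * ?n) = real H powr (real ?n ^ 2 + real m * real ?n - real ?n)"
      using elim by (subst powr_realpow[symmetric]) (auto simp: k algebra_simps)
    ultimately show ?case
      using elim by (simp add: powr_diff[of _ _ \<epsilon>] pos_divide_le_eq mult.commute)
  qed
qed

section \<open>The upper bound\<close>

text \<open>The type argument carries the dimension, which \<open>p\<close> does not
  determine.\<close>

definition singular_density :: "'n::finite itself \<Rightarrow> nat \<Rightarrow> real" where
  "singular_density _ p = real (card {A \<in> residue_mats p. singular_mod p (A :: int^'n^'n)}) / real p ^ CARD('n)\<^sup>2"

lemma singular_density_nonneg: "singular_density TYPE('n::finite) p \<ge> 0"
  by (simp add: singular_density_def)

lemma singular_density_le_1: "singular_density TYPE('n::finite) p \<le> 1"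
proof -
  have "card {A \<in> residue_mats p. singular_mod p (A :: int^'n^'n)} \<le> p ^ CARD('n)\<^sup>2"
    using card_mono[OF finite_residue_mats, of "{A \<in> residue_mats p. singular_mod p (A :: int^'n^'n)}" p]
    by (auto simp: card_residue_mats)
  then have "real (card {A \<in> residue_mats p. singular_mod p (A :: int^'n^'n)}) \<le> real p ^ CARD('n)\<^sup>2"
    by (metis of_nat_le_iff of_nat_power)
  then show ?thesis by (auto simp: singular_density_def divide_le_eq_1)
qed

text \<open>Every matrix modulo \<open>p\<close> arises from a singular one by adding some
  \<open>t\<close> to one entry of a fixed row \<open>i0\<close>. There are
  \<open>CARD('n) * p\<close> such changes, so the singular matrices make up at least the inverse of
  this proportion.\<close>

lemma singular_density_ge:
  assumes p: "prime p"
  shows "singular_density TYPE('n::finite) p \<ge> 1 / (real CARD('n) * real p)"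
proof -
  obtain i0 :: 'n where True by blast
  let ?S = "{A \<in> residue_mats p. singular_mod p (A :: int^'n^'n)}"
  let ?f = "\<lambda>(B :: int^'n^'n, j, t). (\<chi> i k. if i = i0 \<and> k = j then (B $ i $ k + t) mod int p else B $ i $ k) :: int^'n^'n"
  have p0: "p > 0" using p by (simp add: prime_gt_0_nat)
  have sub: "residue_mats p \<subseteq> ?f ` (?S \<times> (UNIV \<times> {0..<int p}))"
  proof
    fix A :: "int^'n^'n" assume A: "A \<in> residue_mats p"
    show "A \<in> ?f ` (?S \<times> (UNIV \<times> {0..<int p}))"
    proof (cases "singular_mod p A")
      case True
      with A p0 show ?thesis
        by (intro image_eqI[of _ _ "(A, i0, 0)"]) (auto simp: vec_eq_iff residue_mats_def)
    next
      case False
      \<comment> \<open>This \<open>w\<close> is column \<open>i0\<close> of the inverse modulo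
        \<open>p\<close>. Subtracting the inverse \<open>s\<close> of \<open>w $ j\<close> from the
        entry \<open>(i0, j)\<close> changes only coordinate \<open>i0\<close> of
        \<open>A *v w\<close>, from 1 to 0, which makes \<open>w\<close> a kernel vector.\<close>
      obtain w where w: "\<And>i. [(A *v w) $ i = axis i0 1 $ i] (mod int p)"
        using not_singular_mod_imp_surj[OF p0 False] by blast
      have "\<exists>j. \<not> int p dvd w $ j"
      proof (rule ccontr)
        assume "\<not> (\<exists>j. \<not> int p dvd w $ j)"
        then have "int p dvd (A *v w) $ i0" unfolding matrix_vector_mult_def by (auto intro!: dvd_sum)
        then have "int p dvd 1" using cong_dvd_iff[OF w[of i0]] by (simp add: axis_def)
        with p show False using not_prime_unit by auto
      qed
      then obtain j where j: "\<not> int p dvd w $ j" by blast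
      then have "coprime (w $ j) (int p)"
        using p by (metis coprime_commute prime_imp_coprime prime_nat_int_transfer)
      then obtain s where s: "[w $ j * s = 1] (mod int p)" using cong_solve_coprime_int by blast
      define B where "B = (\<chi> i k. A $ i $ k - (if i = i0 \<and> k = j then s else 0))"
      have Bv: "(B *v w) $ i = (A *v w) $ i - (if i = i0 then s * w $ j else 0)" for i
      proof -
        have "(B *v w) $ i = (\<Sum>k\<in>UNIV. A $ i $ k * w $ k - (if k = j then (if i = i0 then s * w $ j else 0) else 0))"
          unfolding matrix_vector_mult_def B_def by (auto intro!: sum.cong simp: algebra_simps)
        also have "\<dots> = (A *v w) $ i - (if i = i0 then s * w $ j else 0)"
          by (simp add: sum_subtractf matrix_vector_mult_def)
        finally show ?thesis .
      qed
      have "[(B *v w) $ i = axis i0 1 $ i - (if i = i0 then 1 else 0)] (mod int p)" for i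
        unfolding Bv using w[of i] s by (intro cong_diff) (auto simp: mult.commute)
      then have "int p dvd (B *v w) $ i" for i
        by (auto simp: axis_def cong_0_iff split: if_splits)
      then have "singular_mod p B" using j unfolding singular_mod_def by blast
      then have "mat_mod p B \<in> ?S"
        using mat_mod_in_residue_mats[OF p0] singular_mod_cong[OF mat_cong_mat_mod] by blast
      moreover have "A = ?f (mat_mod p B, j, s mod int p)"
        using A by (auto simp: vec_eq_iff mat_mod_def B_def residue_mats_def mod_simps)
      ultimately show ?thesis using p0 by (intro image_eqI[of _ _ "(mat_mod p B, j, s mod int p)"]) auto
    qed
  qed
  have finS: "finite ?S" by (rule finite_subset[OF _ finite_residue_mats]) auto
  have "p ^ CARD('n)\<^sup>2 \<le> card (?f ` (?S \<times> (UNIV \<times> {0..<int p})))"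
    unfolding card_residue_mats[symmetric, where ?'n = 'n] using sub finS by (intro card_mono) auto
  also have "\<dots> \<le> card (?S \<times> ((UNIV :: 'n set) \<times> {0..<int p}))"
    using finS by (intro card_image_le) auto
  also have "\<dots> = card ?S * (CARD('n) * p)" by (simp add: card_cartesian_product)
  finally have "real (p ^ CARD('n)\<^sup>2) \<le> real (card ?S * (CARD('n) * p))" by (simp only: of_nat_le_iff)
  then show ?thesis using p0 by (simp add: singular_density_def field_simps)
qed

text \<open>A kernel vector can be scaled to have the coordinate 1 at some position
  \<open>j\<close>; column \<open>j\<close> is then determined by the vector and the other columns.
  There are \<open>n\<close> positions, \<open>p^(n-1)\<close> vectors and \<open>p^(n^2-n)\<close>
  choices of columns.\<close>

lemma singular_density_le:
  assumes p: "prime p"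
  shows "singular_density TYPE('n::finite) p \<le> real CARD('n) / real p"
proof -
  let ?S = "{A \<in> residue_mats p. singular_mod p (A :: int^'n^'n)}"
  let ?V = "\<lambda>j. {v :: int^'n. \<forall>i. v $ i \<in> (if i = j then {1} else {0..<int p})}"
  \<comment> \<open>Column \<open>j\<close> is filled with zeros as a placeholder, so that
    \<open>M *v v\<close> combines only the other columns.\<close>
  let ?M = "\<lambda>j. {M :: int^'n^'n. \<forall>i. M $ i \<in> {r. \<forall>k. r $ k \<in> (if k = j then {0} else {0..<int p})}}"
  let ?f = "\<lambda>(j, v :: int^'n, M :: int^'n^'n). (\<chi> i k. if k = j then (- (M *v v) $ i) mod int p else M $ i $ k) :: int^'n^'n"
  have p0: "p > 0" and p1: "p > 1" using p prime_gt_0_nat prime_gt_1_nat by auto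
  have sub: "?S \<subseteq> ?f ` (SIGMA j : UNIV. ?V j \<times> ?M j)"
  proof
    fix A :: "int^'n^'n" assume A: "A \<in> ?S"
    then obtain v j where v: "\<not> int p dvd v $ j" "\<And>i. int p dvd (A *v v) $ i"
      by (auto simp: singular_mod_def)
    have "coprime (v $ j) (int p)"
      using v(1) p by (metis coprime_commute prime_imp_coprime prime_nat_int_transfer)
    then obtain s where s: "[v $ j * s = 1] (mod int p)" using cong_solve_coprime_int by blast
    define u where "u = (\<chi> k. (v $ k * s) mod int p)"
    define M where "M = (\<chi> i k. if k = j then 0 else A $ i $ k)"
    have uj: "u $ j = 1" using s p1 by (simp add: u_def cong_def)
    have M_row: "(M *v u) $ i = (A *v u) $ i - A $ i $ j" for i
    proof -
      have "(M *v u) $ i = (\<Sum>k\<in>UNIV. A $ i $ k * u $ k - (if k = j then A $ i $ j else 0))"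
        unfolding matrix_vector_mult_def M_def using uj by (auto intro!: sum.cong)
      then show ?thesis by (simp add: sum_subtractf matrix_vector_mult_def)
    qed
    have "[(A *v u) $ i = (A *v v) $ i * s] (mod int p)" for i
      unfolding matrix_vector_mult_def u_def
      by (auto intro!: cong_sum cong_mult simp: sum_distrib_right mult.assoc)
    then have "int p dvd (A *v u) $ i" for i
      using v(2) cong_dvd_iff by (metis dvd_mult2)
    then have "[- (M *v u) $ i = A $ i $ j] (mod int p)" for i
      unfolding M_row by (simp add: cong_iff_dvd_diff)
    then have "(- (M *v u) $ i) mod int p = A $ i $ j" for i
      using A by (simp add: cong_def residue_mats_def)
    then have "A = ?f (j, u, M)" by (simp add: vec_eq_iff M_def)
    moreover have "u \<in> ?V j" using uj p0 by (auto simp: u_def)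
    moreover have "M \<in> ?M j" using A by (auto simp: M_def residue_mats_def)
    ultimately show "A \<in> ?f ` (SIGMA j : UNIV. ?V j \<times> ?M j)"
      by (intro image_eqI[of _ _ "(j, u, M)"]) auto
  qed
  have V: "finite (?V j)" "card (?V j) * p = p ^ CARD('n)" for j :: 'n
  proof -
    show "finite (?V j)" by (rule finite_vec_set) auto
    have "card (?V j) = (\<Prod>i\<in>UNIV. if i = j then 1 else p)"
      by (subst card_vec_set) (auto intro!: prod.cong)
    also have "\<dots> = (\<Prod>i\<in>UNIV - {j}. p)" by (subst prod.remove[of _ j]) auto
    finally show "card (?V j) * p = p ^ CARD('n)"
      by (simp add: card_Diff_singleton mult.commute power_Suc[symmetric] del: power_Suc)
  qed
  have M: "finite (?M j)" "card (?M j) * p ^ CARD('n) = p ^ CARD('n)\<^sup>2" for j :: 'n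
  proof -
    let ?R = "{r :: int^'n. \<forall>k. r $ k \<in> (if k = j then {0} else {0..<int p})}"
    have finR: "finite ?R" by (rule finite_vec_set) auto
    then show "finite (?M j)" by (rule finite_vec_set)
    have "card ?R = (\<Prod>i\<in>UNIV. if i = j then 1 else p)"
      by (subst card_vec_set) (auto intro!: prod.cong)
    also have "\<dots> = (\<Prod>i\<in>UNIV - {j}. p)" by (subst prod.remove[of _ j]) auto
    finally have R: "card ?R * p = p ^ CARD('n)"
      by (simp add: card_Diff_singleton mult.commute power_Suc[symmetric] del: power_Suc)
    have "card (?M j) = card ?R ^ CARD('n)" using finR by (subst card_vec_set) auto
    then have "card (?M j) * p ^ CARD('n) = (card ?R * p) ^ CARD('n)" by (simp only: power_mult_distrib)
    then show "card (?M j) * p ^ CARD('n) = p ^ CARD('n)\<^sup>2"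
      unfolding R by (simp add: power_mult power2_eq_square)
  qed
  have "card ?S \<le> card (?f ` (SIGMA j : UNIV. ?V j \<times> ?M j))"
    using sub V(1) M(1) by (intro card_mono finite_imageI finite_SigmaI finite_cartesian_product) auto
  also have "\<dots> \<le> card (SIGMA j : UNIV. ?V j \<times> ?M j)"
    using V(1) M(1) by (intro card_image_le finite_SigmaI finite_cartesian_product) auto
  also have "\<dots> = (\<Sum>j\<in>UNIV. card (?V j \<times> ?M j))"
    using V(1) M(1) by (intro card_SigmaI) auto
  \<comment> \<open>Multiplying by \<open>p * p ^ CARD('n)\<close> avoids exponents with
    subtraction: one factor completes \<open>?V j\<close>, the other \<open>?M j\<close>.\<close>
  finally have "card ?S * (p * p ^ CARD('n)) \<le> (\<Sum>j\<in>UNIV. card (?V j \<times> ?M j)) * (p * p ^ CARD('n))"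
    by (rule mult_right_mono) simp
  also have "\<dots> = (\<Sum>j\<in>UNIV. (card (?V j) * p) * (card (?M j) * p ^ CARD('n)))"
    unfolding sum_distrib_right card_cartesian_product by (simp only: mult_ac)
  also have "\<dots> = CARD('n) * (p ^ CARD('n) * p ^ CARD('n)\<^sup>2)"
    unfolding V(2) M(2) by simp
  finally have "real (card ?S * (p * p ^ CARD('n))) \<le> real (CARD('n) * (p ^ CARD('n) * p ^ CARD('n)\<^sup>2))"
    by (simp only: of_nat_le_iff)
  then show ?thesis using p0 by (simp add: singular_density_def field_simps)
qed

section \<open>Multiplicative weights and their averages\<close>

text \<open>The values \<open>x = 2\<close>, \<open>y = 1\<close> give \<open>2^N\<close>, and
  \<open>x = 1 / 2\<close>, \<open>y = 1\<close> give \<open>2^-N\<close>, with \<open>N\<close> the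
  number of primes in \<open>P\<close> modulo which \<open>A\<close> is singular. General
  \<open>x\<close> and \<open>y\<close> are kept because averaging over a factor yields another
  weight with the same \<open>x\<close> and a new \<open>y\<close>.\<close>

definition weight :: "nat set \<Rightarrow> (nat \<Rightarrow> real) \<Rightarrow> (nat \<Rightarrow> real) \<Rightarrow> int^'n^'n \<Rightarrow> real" where
  "weight P x y A = (\<Prod>p\<in>P. if singular_mod p A then x p else y p)"

lemma weight_nonneg:
  "(\<And>p. p \<in> P \<Longrightarrow> x p \<ge> 0) \<Longrightarrow> (\<And>p. p \<in> P \<Longrightarrow> y p \<ge> 0) \<Longrightarrow> weight P x y A \<ge> 0"
  unfolding weight_def by (intro prod_nonneg) auto

lemma weight_mat_1: "weight P x y (mat 1) = (\<Prod>p\<in>P. y p)"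
  unfolding weight_def by (simp add: not_singular_mod_mat_1)

text \<open>If \<open>C\<close> is singular, so is every \<open>A ** C\<close>; otherwise
  \<open>A ** C\<close> is singular exactly when \<open>A\<close> is, which has density
  \<alpha>.\<close>

lemma sum_residue_mats_mult_right:
  fixes C :: "int^'n::finite^'n"
  assumes "p > 0"
  defines "\<alpha> \<equiv> singular_density TYPE('n) p"
  shows "(\<Sum>A\<in>residue_mats p. if singular_mod p (A ** C) then x else y) / real p ^ CARD('n)\<^sup>2
    = (if singular_mod p C then x else \<alpha> * x + (1 - \<alpha>) * y)"
proof -
  let ?R = "residue_mats p :: (int^'n^'n) set"
  let ?S = "{A \<in> ?R. singular_mod p A}"
  have R: "real (card ?R) = real p ^ CARD('n)\<^sup>2" by (simp add: card_residue_mats)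
  have pos: "real p ^ CARD('n)\<^sup>2 > 0" using assms by simp
  show ?thesis
  proof (cases "singular_mod p C")
    case True
    then show ?thesis using R pos assms(1) by (simp add: singular_mod_mult_iff)
  next
    case False
    have "(\<Sum>A\<in>?R. if singular_mod p (A ** C) then x else y) = (\<Sum>A\<in>?R. y + (if singular_mod p A then x - y else 0))"
      using assms(1) False by (intro sum.cong) (auto simp: singular_mod_mult_iff)
    also have "\<dots> = real (card ?R) * y + real (card ?S) * (x - y)"
      by (simp add: sum.distrib sum.If_cases finite_residue_mats Int_def)
    also have "real (card ?S) = \<alpha> * real p ^ CARD('n)\<^sup>2"
      using pos by (simp add: \<alpha>_def singular_density_def)
    finally show ?thesis using False pos R by (simp add: field_simps)
  qed
qed

text \<open>The weight depends only on residues modulo \<open>\<Prod>P\<close>, so the box sum is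
  bounded by a residue mean, which factors into the local means over the primes in
  \<open>P\<close>.\<close>

lemma sum_bounded_mats_weight_le:
  fixes C :: "int^'n::finite^'n"
  assumes P: "finite P" "\<And>p. p \<in> P \<Longrightarrow> prime p" "\<Prod>P \<le> X"
    and nonneg: "\<And>p. p \<in> P \<Longrightarrow> x p \<ge> 0" "\<And>p. p \<in> P \<Longrightarrow> y p \<ge> 0"
  defines "\<alpha> \<equiv> singular_density TYPE('n)"
  shows "(\<Sum>A\<in>bounded_mats X. weight P x y (A ** C))
    \<le> (4 * real X) ^ CARD('n)\<^sup>2 * weight P x (\<lambda>p. \<alpha> p * x p + (1 - \<alpha> p) * y p) C"
proof -
  have pos: "p > 0" if "p \<in> P" for p using P(2)[OF that] by (simp add: prime_gt_0_nat)
  let ?f = "\<lambda>p A. if singular_mod p (A ** C) then x p else y p"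
  have f: "?f p A = ?f p B" if "mat_cong p A B" for p A B
    using singular_mod_cong[OF mat_cong_mult_right[OF that]] by simp
  have "(\<Sum>A\<in>bounded_mats X. weight P x y (A ** C))
    \<le> (4 * real X) ^ CARD('n)\<^sup>2 * ((\<Sum>A\<in>residue_mats (\<Prod>P). weight P x y (A ** C)) / real (\<Prod>P) ^ CARD('n)\<^sup>2)"
  proof (rule sum_bounded_mats_le)
    show "\<Prod>P > 0" using pos by (intro prod_pos) auto
    show "weight P x y (A ** C) = weight P x y (B ** C)" if "mat_cong (\<Prod>P) A B" for A B
      unfolding weight_def using P(1) that
      by (intro prod.cong refl f) (auto intro: mat_cong_dvd dvd_prodI)
  qed (use P in \<open>auto intro!: weight_nonneg nonneg\<close>)
  also have "(\<Sum>A\<in>residue_mats (\<Prod>P). weight P x y (A ** C)) = (\<Prod>p\<in>P. \<Sum>A\<in>residue_mats p. ?f p A)"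
    unfolding weight_def by (rule sum_residue_mats_prod[OF P(1,2) f])
  also have "\<dots> / real (\<Prod>P) ^ CARD('n)\<^sup>2 = (\<Prod>p\<in>P. (\<Sum>A\<in>residue_mats p. ?f p A) / real p ^ CARD('n)\<^sup>2)"
    by (simp add: prod_dividef prod_power_distrib)
  also have "\<dots> = weight P x (\<lambda>p. \<alpha> p * x p + (1 - \<alpha> p) * y p) C"
    unfolding weight_def \<alpha>_def by (intro prod.cong refl sum_residue_mats_mult_right pos)
  finally show ?thesis .
qed

text \<open>Summing over one factor after the other leaves \<open>x\<close> fixed and contracts
  \<open>y - x\<close> by \<open>1 - \<alpha> p\<close> each time, until only the identity matrix is
  left, whose weight is the product of the final values of \<open>y\<close>.\<close>

lemma sum_W_set_weight_le:
  fixes x y :: "nat \<Rightarrow> real"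
  assumes P: "finite P" "\<And>p. p \<in> P \<Longrightarrow> prime p" "\<Prod>P \<le> H"
    and nonneg: "\<And>p. p \<in> P \<Longrightarrow> x p \<ge> 0" "\<And>p. p \<in> P \<Longrightarrow> y p \<ge> 0"
  defines "\<alpha> \<equiv> singular_density TYPE('n::finite)"
  shows "(\<Sum>B\<in>(W_set m H :: (int^'n^'n) set). weight P x y B)
    \<le> (4 * real H) ^ (m * CARD('n)\<^sup>2) * (\<Prod>p\<in>P. x p + (1 - \<alpha> p) ^ m * (y p - x p))"
  using nonneg(2)
\<comment> \<open>The induction hypothesis is applied to the averaged function
  \<open>?y\<close>.\<close>
proof (induction m arbitrary: y)
  case 0
  then show ?case by (simp add: W_set_0 weight_mat_1)
next
  case (Suc m)
  let ?c = "(4 * real H) ^ CARD('n)\<^sup>2"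
  let ?W = "W_set m H :: (int^'n^'n) set"
  let ?y = "\<lambda>p. \<alpha> p * x p + (1 - \<alpha> p) * y p"
  \<comment> \<open>The product set is replaced by pairs of factors; repeated products only increase
    the sum, since the weights are nonnegative.\<close>
  have "(\<Sum>B\<in>(W_set (Suc m) H :: (int^'n^'n) set). weight P x y B) \<le> (\<Sum>z\<in>bounded_mats H \<times> ?W. weight P x y (case z of (A, C) \<Rightarrow> A ** C))"
    unfolding W_set_Suc
    by (rule order_trans[OF sum_image_le])
      (auto simp: o_def finite_bounded_mats finite_W_set intro!: weight_nonneg nonneg(1) Suc.prems)
  also have "\<dots> = (\<Sum>A\<in>bounded_mats H. \<Sum>C\<in>?W. weight P x y (A ** C))"
    unfolding sum.cartesian_product by (rule sum.cong) auto
  also have "\<dots> = (\<Sum>C\<in>?W. \<Sum>A\<in>bounded_mats H. weight P x y (A ** C))"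
    by (rule sum.swap)
  also have "\<dots> \<le> (\<Sum>C\<in>?W. ?c * weight P x ?y C)"
    unfolding \<alpha>_def using P nonneg(1) Suc.prems by (intro sum_mono sum_bounded_mats_weight_le) auto
  also have "\<dots> = ?c * (\<Sum>C\<in>?W. weight P x ?y C)"
    by (simp add: sum_distrib_left)
  also have "\<dots> \<le> ?c * ((4 * real H) ^ (m * CARD('n)\<^sup>2) * (\<Prod>p\<in>P. x p + (1 - \<alpha> p) ^ m * (?y p - x p)))"
    unfolding \<alpha>_def using nonneg(1) Suc.prems singular_density_nonneg[where ?'n = 'n] singular_density_le_1[where ?'n = 'n]
    by (intro mult_left_mono Suc.IH[unfolded \<alpha>_def]) auto
  also have "(\<Prod>p\<in>P. x p + (1 - \<alpha> p) ^ m * (?y p - x p)) = (\<Prod>p\<in>P. x p + (1 - \<alpha> p) ^ Suc m * (y p - x p))"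
    by (intro prod.cong refl) (simp add: algebra_simps)
  finally show ?case by (simp add: power_add mult.assoc)
qed

section \<open>Comparison of the two distributions and conclusion\<close>

text \<open>To first order the left side is \<open>1 + (2 - m / 2) * a\<close>, so
  \<open>m \<ge> 6\<close> gives at most \<open>1 - a\<close>. Half of this gain pays for the terms
  of higher order when \<open>a \<le> 1 / 10\<close>.\<close>

lemma weight_inequality:
  fixes a :: real
  assumes "0 \<le> a" "a \<le> 1 / 10" "m \<ge> 6"
  shows "(1 + a)\<^sup>2 * (1 / 2 + (1 - a) ^ m * (1 - 1 / 2)) \<le> 1 - a / 2"
proof -
  have "(1 - a) ^ m \<le> (1 - a) ^ 6" using assms by (intro power_decreasing) auto
  also have "(1 - a) ^ 6 = 1 - 6 * a + 15 * a\<^sup>2 - a ^ 3 * (20 - 15 * a + a\<^sup>2 * (6 - a))"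
    by (simp add: algebra_simps eval_nat_numeral)
  also have "\<dots> \<le> 1 - 6 * a + 15 * a\<^sup>2"
  proof -
    have "a\<^sup>2 * (6 - a) \<ge> 0" using assms by simp
    then have "a ^ 3 * (20 - 15 * a + a\<^sup>2 * (6 - a)) \<ge> 0" using assms by (intro mult_nonneg_nonneg) auto
    then show ?thesis by simp
  qed
  finally have "(1 + a)\<^sup>2 * (1 / 2 + (1 - a) ^ m * (1 - 1 / 2)) \<le> (1 + a)\<^sup>2 * (1 / 2 + (1 - 6 * a + 15 * a\<^sup>2) * (1 - 1 / 2))"
    by (intro mult_left_mono) auto
  also have "\<dots> = 1 - a + a * (a * (5 / 2 + a * (12 + 15 / 2 * a)))"
    by (simp add: field_simps eval_nat_numeral)
  \<comment> \<open>Putting \<open>a = 1 / 10\<close> into the inner factor gives 0.3775, which is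
    below 1/2.\<close>
  also have "\<dots> \<le> 1 - a + a * (1 / 10 * (5 / 2 + 1 / 10 * (12 + 15 / 2 * (1 / 10))))"
    using assms by (intro add_left_mono mult_left_mono mult_mono) auto
  also have "\<dots> \<le> 1 - a / 2" using assms by simp
  finally show ?thesis .
qed

text \<open>\<open>P\<close> does not depend on \<open>H\<close> beyond
  \<open>\<Prod>P \<le> H\<close>, so a fixed \<open>P\<close> serves all large \<open>H\<close>.
  The saving over the trivial order of magnitude is the product over \<open>P\<close>.\<close>

lemma card_W_set_le:
  fixes m H :: nat
  assumes P: "finite P" "\<And>p. p \<in> P \<Longrightarrow> prime p" "\<Prod>P \<le> H"
    and \<alpha>_le: "\<And>p. p \<in> P \<Longrightarrow> singular_density TYPE('n::finite) p \<le> 1 / 10"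
    and m: "m \<ge> 6"
  shows "real (card (W_set m H :: (int^'n^'n) set))
    \<le> ((4 * real CARD('n) ^ m) ^ CARD('n)\<^sup>2 + 4 ^ (m * CARD('n)\<^sup>2)) *
      (\<Prod>p\<in>P. 1 - singular_density TYPE('n) p / 2) * real H ^ (m * CARD('n)\<^sup>2)"
proof -
  let ?n = "CARD('n)"
  let ?W = "W_set m H :: (int^'n^'n) set"
  define \<alpha> where "\<alpha> = singular_density TYPE('n)"
  define X where "X = (?n * H) ^ m"
  define \<pi> where "\<pi> = (\<Prod>p\<in>P. 1 - \<alpha> p / 2)"
  \<comment> \<open>To first order in \<open>\<alpha>\<close>, each prime contributes \<open>1 + \<alpha>\<close> to the mean of \<open>2^N\<close> over the box and
    \<open>1 - m \<alpha> / 2\<close> to that of \<open>2^-N\<close> over the products. With this \<open>c\<close> the factors become \<open>1 - \<alpha>\<close>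
    and \<open>1 + (2 - m / 2) \<alpha>\<close>, which for \<open>m \<ge> 6\<close> are both at most \<open>1 - \<alpha>\<close>.\<close>
  define c where "c = (\<Prod>p\<in>P. (1 + \<alpha> p)\<^sup>2)"
  have \<alpha>: "0 \<le> \<alpha> p" "\<alpha> p \<le> 1 / 10" if "p \<in> P" for p
    using that \<alpha>_le singular_density_nonneg by (auto simp: \<alpha>_def)
  have c: "c > 0" unfolding c_def using \<alpha> by (intro prod_pos) (smt (verit) zero_less_power)
  have HX: "H \<le> X"
  proof -
    have "H \<le> ?n * H" by simp
    also have "\<dots> \<le> X"
      unfolding X_def using m by (cases "H = 0") (auto intro!: self_le_power)
    finally show ?thesis .
  qed
  let ?F = "weight P (\<lambda>_. 2) (\<lambda>_. 1)"
  let ?G = "weight P (\<lambda>_. 1 / 2) (\<lambda>_. 1)"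
  have F: "?F B > 0" for B :: "int^'n^'n" unfolding weight_def by (intro prod_pos) auto
  have FG: "?F B * ?G B = 1" for B :: "int^'n^'n"
    unfolding weight_def prod.distrib[symmetric] by (intro prod.neutral) auto
  have "1 \<le> ?F B / c + c * ?G B" for B :: "int^'n^'n"
  proof -
    have "?G B = 1 / ?F B" using FG[of B] F[of B] by (simp add: field_simps)
    moreover have "1 \<le> ?F B / c + c / ?F B"
    proof (cases "?F B \<ge> c")
      case True
      then have "1 \<le> ?F B / c" "0 \<le> c / ?F B" using c by auto
      then show ?thesis by simp
    next
      case False
      then have "1 \<le> c / ?F B" "0 \<le> ?F B / c" using c F[of B] by auto
      then show ?thesis by simp
    qed
    ultimately show ?thesis by simp
  qed
  then have "real (card ?W) \<le> (\<Sum>B\<in>?W. ?F B / c + c * ?G B)"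
    using sum_mono[of ?W "\<lambda>_. 1" "\<lambda>B. ?F B / c + c * ?G B"] by simp
  also have "\<dots> = (\<Sum>B\<in>?W. ?F B) / c + c * (\<Sum>B\<in>?W. ?G B)"
    by (simp add: sum.distrib sum_divide_distrib sum_distrib_left)
  also have "(\<Sum>B\<in>?W. ?F B) / c \<le> (4 * real ?n ^ m) ^ ?n\<^sup>2 * \<pi> * real H ^ (m * ?n\<^sup>2)"
  proof -
    have "(\<Sum>B\<in>?W. ?F B) \<le> (\<Sum>B\<in>(bounded_mats X :: (int^'n^'n) set). ?F B)"
      unfolding X_def
      by (intro sum_mono2 W_set_subset_bounded_mats finite_bounded_mats) (rule less_imp_le[OF F])
    \<comment> \<open>With the identity as right factor, the bound for one averaged factor covers
      the whole box.\<close>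
    also have "\<dots> = (\<Sum>B\<in>(bounded_mats X :: (int^'n^'n) set). ?F (B ** mat 1))" by simp
    also have "\<dots> \<le> (4 * real X) ^ ?n\<^sup>2 * weight P (\<lambda>_. 2) (\<lambda>p. \<alpha> p * 2 + (1 - \<alpha> p) * 1) (mat 1 :: int^'n^'n)"
      unfolding \<alpha>_def using P HX by (intro sum_bounded_mats_weight_le) auto
    also have "\<dots> = (4 * real X) ^ ?n\<^sup>2 * (\<Prod>p\<in>P. 1 + \<alpha> p)"
      by (simp add: weight_mat_1 add.commute)
    finally have "(\<Sum>B\<in>?W. ?F B) / c \<le> (4 * real X) ^ ?n\<^sup>2 * (\<Prod>p\<in>P. 1 + \<alpha> p) / c"
      using c by (intro divide_right_mono) auto
    also have "\<dots> = (4 * real X) ^ ?n\<^sup>2 * (\<Prod>p\<in>P. (1 + \<alpha> p) / (1 + \<alpha> p)\<^sup>2)"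
      by (simp add: c_def prod_dividef)
    also have "\<dots> \<le> (4 * real X) ^ ?n\<^sup>2 * \<pi>"
      unfolding \<pi>_def
    proof (intro mult_left_mono prod_mono conjI)
      fix p assume "p \<in> P"
      note \<alpha>[OF this]
      moreover from this have "\<alpha> p * \<alpha> p \<le> \<alpha> p * 1" by (intro mult_left_mono) auto
      \<comment> \<open>After clearing denominators this is
        \<open>\<alpha> p * \<alpha> p \<le> \<alpha> p\<close>.\<close>
      ultimately have "1 / (1 + \<alpha> p) \<le> 1 - \<alpha> p / 2"
        by (simp add: field_simps)
      then show "(1 + \<alpha> p) / (1 + \<alpha> p)\<^sup>2 \<le> 1 - \<alpha> p / 2"
        by (simp add: power2_eq_square)
      show "0 \<le> (1 + \<alpha> p) / (1 + \<alpha> p)\<^sup>2" using \<alpha>[OF \<open>p \<in> P\<close>] by simp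
    qed auto
    also have "(4 * real X) ^ ?n\<^sup>2 = (4 * real ?n ^ m) ^ ?n\<^sup>2 * real H ^ (m * ?n\<^sup>2)"
      by (simp add: X_def power_mult_distrib power_mult)
    finally show ?thesis by (simp add: mult_ac)
  qed
  also have "c * (\<Sum>B\<in>?W. ?G B) \<le> 4 ^ (m * ?n\<^sup>2) * \<pi> * real H ^ (m * ?n\<^sup>2)"
  proof -
    have "c * (\<Sum>B\<in>?W. ?G B) \<le> c * ((4 * real H) ^ (m * ?n\<^sup>2) * (\<Prod>p\<in>P. 1 / 2 + (1 - \<alpha> p) ^ m * (1 - 1 / 2)))"
      unfolding \<alpha>_def using P c by (intro mult_left_mono sum_W_set_weight_le) auto
    also have "\<dots> = (4 * real H) ^ (m * ?n\<^sup>2) * (\<Prod>p\<in>P. (1 + \<alpha> p)\<^sup>2 * (1 / 2 + (1 - \<alpha> p) ^ m * (1 - 1 / 2)))"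
      unfolding c_def prod.distrib by (simp only: mult_ac)
    also have "\<dots> \<le> (4 * real H) ^ (m * ?n\<^sup>2) * \<pi>"
      unfolding \<pi>_def
    proof (intro mult_left_mono prod_mono conjI weight_inequality m)
      fix p assume p: "p \<in> P"
      show "0 \<le> \<alpha> p" "\<alpha> p \<le> 1 / 10" using \<alpha>[OF p] .
      have "(1 - \<alpha> p) ^ m \<ge> 0" using \<alpha>[OF p] by simp
      then show "0 \<le> (1 + \<alpha> p)\<^sup>2 * (1 / 2 + (1 - \<alpha> p) ^ m * (1 - 1 / 2))" by simp
    qed auto
    finally show ?thesis by (simp add: power_mult_distrib mult_ac)
  qed
  finally show ?thesis by (simp add: \<pi>_def \<alpha>_def algebra_simps)
qed

text \<open>The densities have a divergent sum over the primes, so a suitable finite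
  \<open>P\<close> makes the saving smaller than any given constant; then \<open>H\<close> tends to
  infinity with \<open>P\<close> fixed.\<close>

lemma card_W_set_smallo:
  assumes "m \<ge> 6"
  shows "(\<lambda>H. real (card (W_set m H :: (int^'n::finite^'n) set))) \<in> o(\<lambda>H. real H ^ (m * CARD('n)\<^sup>2))"
proof (rule landau_o.smallI)
  fix e :: real assume e: "e > 0"
  let ?n = "CARD('n)"
  define K where "K = (4 * real ?n ^ m) ^ ?n\<^sup>2 + 4 ^ (m * ?n\<^sup>2)"
  have K: "K > 0" unfolding K_def by (intro add_pos_pos) auto
  define \<alpha> where "\<alpha> = singular_density TYPE('n)"
  \<comment> \<open>Primes above \<open>10 * ?n\<close> have singular density at most 1/10. The
    lower bound on the sum is what \<open>exp (- (1 / (2 * n)) * sum)\<close> needs to drop to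
    \<open>e / K\<close>, the rate \<open>1 / (2 * n)\<close> coming from half the density bound
    \<open>1 / (n * p)\<close>.\<close>
  obtain P where P: "finite P" "\<And>p. p \<in> P \<Longrightarrow> prime p" "\<And>p. p \<in> P \<Longrightarrow> p > 10 * ?n"
    and large: "(\<Sum>p\<in>P. 1 / real p) \<ge> 2 * real ?n * - ln (e / K)"
    using sum_reciprocal_primes_unbounded[of "10 * ?n" "2 * real ?n * - ln (e / K)"] by metis
  have \<alpha>_le: "\<alpha> p \<le> 1 / 10" if "p \<in> P" for p
  proof -
    have "\<alpha> p \<le> real ?n / real p" unfolding \<alpha>_def using P(2)[OF that] by (rule singular_density_le)
    also have "\<dots> \<le> 1 / 10" using P(3)[OF that] by (simp add: field_simps)
    finally show ?thesis .
  qed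
  have "(\<Prod>p\<in>P. 1 - \<alpha> p / 2) \<le> (\<Prod>p\<in>P. exp (- (1 / (2 * real ?n)) * (1 / real p)))"
  proof (intro prod_mono conjI)
    fix p assume p: "p \<in> P"
    show "0 \<le> 1 - \<alpha> p / 2" using \<alpha>_le[OF p] by simp
    have "1 - \<alpha> p / 2 \<le> 1 + - (1 / (2 * real ?n)) * (1 / real p)"
      using singular_density_ge[OF P(2)[OF p], where ?'n = 'n] by (simp add: \<alpha>_def)
    also have "\<dots> \<le> exp (- (1 / (2 * real ?n)) * (1 / real p))" by (rule exp_ge_add_one_self)
    finally show "1 - \<alpha> p / 2 \<le> exp (- (1 / (2 * real ?n)) * (1 / real p))" .
  qed
  also have "\<dots> = exp (- (1 / (2 * real ?n)) * (\<Sum>p\<in>P. 1 / real p))"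
    unfolding sum_distrib_left using P(1) by (simp only: exp_sum)
  also have "\<dots> \<le> exp (ln (e / K))"
    using large by (simp add: field_simps)
  also have "\<dots> = e / K" using e K by simp
  finally have prod_le: "(\<Prod>p\<in>P. 1 - \<alpha> p / 2) \<le> e / K" .
  show "\<forall>\<^sub>F H in at_top. norm (real (card (W_set m H :: (int^'n^'n) set))) \<le> e * norm (real H ^ (m * ?n\<^sup>2))"
    using eventually_ge_at_top[of "\<Prod>P"]
  proof eventually_elim
    case (elim H)
    have "real (card (W_set m H :: (int^'n^'n) set)) \<le> K * (\<Prod>p\<in>P. 1 - \<alpha> p / 2) * real H ^ (m * ?n\<^sup>2)"
      unfolding K_def \<alpha>_def using P(1,2) elim \<alpha>_le[unfolded \<alpha>_def] assms by (rule card_W_set_le)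
    also have "\<dots> \<le> K * (e / K) * real H ^ (m * ?n\<^sup>2)"
      using prod_le K by (intro mult_right_mono mult_left_mono) auto
    finally show ?case using K by simp
  qed
qed

theorem theorem2p3:
  fixes m :: nat
  assumes "m \<ge> 2" and "CARD('n::finite) \<ge> 2"
  shows "(\<forall>\<epsilon>>0. \<forall>\<^sub>F H in at_top.
            real (card (W_set m H :: (int^'n^'n) set))
              \<ge> real H powr (real (CARD('n))^2 + real m * real (CARD('n)) - real (CARD('n)) - \<epsilon>))
         \<and> (m \<ge> 6 \<longrightarrow>
            (\<lambda>H. real (card (W_set m H :: (int^'n^'n) set)))
              \<in> o(\<lambda>H. real H ^ (m * CARD('n)^2)))"
  using card_W_set_ge[where ?'n = 'n, of _ m] card_W_set_smallo[where ?'n = 'n, of m] assms by auto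

end
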